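(* Let $b,c$ be rational numbers with $\Delta\,(bc-1-b)(bc-c-2b)\neq 0$ (where $\Delta$ is as in the context), and suppose $2bc^2-4bc+2b-c^2=0$. Then both cubic polynomials $P(x)$ and $Q(d)$ (defined in the context) are reducible over $\mathbb{Q}$; in this case $P$ has the root $x=0$ and $Q$ has the root $d=1$.
   Context: Let $b,c$ be rational numbers. Put $\Delta=b^2c^4-6b^2c^3+13b^2c^2-12b^2c+4b^2+c^2$ and, when $\Delta\,(bc-1-b)(bc-c-2b)\neq 0$, define (with $D=b^2c^2+2b^2-3b^2c+c-bc^2+2b$): $E_{01}=-\frac{b(c^2+2-2c)}{D}$, $E_{10}=-\frac{b^2c^2+2b^2-3b^2c-c}{D}$; $E_{20}=\frac{b}{2}(bc^2-2c-2b)(2bc^2-c^2-6bc+2+4b)(bc-1-b)^{-2}(bc-c-2b)^{-2}$; $E_{02}=\frac12(28b^2c^2-16b^2c-2c^2-4b^2-b^2c^4+4b^3c^4-12b^3c^3+4bc^3+24b^3c-8bc-2b^4c^4+12b^4c^3-26b^4c^2-8b^2c^3+24b^4c-16b^3-8b^4)(bc-1-b)^{-2}(bc-c-2b)^{-2}$; $E_{03}=\frac{b}{2}(b^2c^4-5b^2c^3+10b^2c^2-10b^2c+4b^2+2bc+2c^2-bc^3)(2b^2c^4-12b^2c^3+26b^2c^2-24b^2c+8b^2-c^4b+3bc^3-6bc+4b+c^3-2c^2+2c)\,\Delta^{-1}(bc-1-b)^{-2}(bc-c-2b)^{-2}$; $E_{30}=c\,b^2(1-c)(c-2)(bc^2-4bc+2+4b)(2bc^2-c^2-4bc+2b)\,\Delta^{-1}(bc-1-b)^{-2}(bc-c-2b)^{-2}$.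 Define $P(x)=x^3-E_{10}x^2+E_{20}x-E_{30}$ and $Q(d)=d^3-E_{01}d^2+E_{02}d-E_{03}$. *)

theory Defs
  imports "HOL-Computational_Algebra.Computational_Algebra"
begin

definition Delta :: "rat \<Rightarrow> rat \<Rightarrow> rat" where
  "Delta b c = b^2*c^4 - 6*b^2*c^3 + 13*b^2*c^2 - 12*b^2*c + 4*b^2 + c^2"

(* DD expands to (b*c - 1 - b) * (b*c - c - 2*b), so every division below is by a
   nonzero number as soon as Delta b c * (b*c - 1 - b) * (b*c - c - 2*b) is nonzero. *)
definition DD :: "rat \<Rightarrow> rat \<Rightarrow> rat" where
  "DD b c = b^2*c^2 + 2*b^2 - 3*b^2*c + c - b*c^2 + 2*b"

definition E01 :: "rat \<Rightarrow> rat \<Rightarrow> rat" where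
  "E01 b c = - (b*(c^2 + 2 - 2*c) / DD b c)"

definition E10 :: "rat \<Rightarrow> rat \<Rightarrow> rat" where
  "E10 b c = - ((b^2*c^2 + 2*b^2 - 3*b^2*c - c) / DD b c)"

definition E20 :: "rat \<Rightarrow> rat \<Rightarrow> rat" where
  "E20 b c = b/2 * (b*c^2 - 2*c - 2*b) * (2*b*c^2 - c^2 - 6*b*c + 2 + 4*b)
     / ((b*c - 1 - b)^2 * (b*c - c - 2*b)^2)"

definition E02 :: "rat \<Rightarrow> rat \<Rightarrow> rat" where
  "E02 b c = 1/2 *
     (28*b^2*c^2 - 16*b^2*c - 2*c^2 - 4*b^2 - b^2*c^4 + 4*b^3*c^4 - 12*b^3*c^3
      + 4*b*c^3 + 24*b^3*c - 8*b*c - 2*b^4*c^4 + 12*b^4*c^3 - 26*b^4*c^2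
      - 8*b^2*c^3 + 24*b^4*c - 16*b^3 - 8*b^4)
     / ((b*c - 1 - b)^2 * (b*c - c - 2*b)^2)"

definition E03 :: "rat \<Rightarrow> rat \<Rightarrow> rat" where
  "E03 b c = b/2 *
     (b^2*c^4 - 5*b^2*c^3 + 10*b^2*c^2 - 10*b^2*c + 4*b^2 + 2*b*c + 2*c^2 - b*c^3) *
     (2*b^2*c^4 - 12*b^2*c^3 + 26*b^2*c^2 - 24*b^2*c + 8*b^2 - c^4*b + 3*b*c^3
      - 6*b*c + 4*b + c^3 - 2*c^2 + 2*c)
     / (Delta b c * (b*c - 1 - b)^2 * (b*c - c - 2*b)^2)"

definition E30 :: "rat \<Rightarrow> rat \<Rightarrow> rat" where
  "E30 b c = c * b^2 * (1 - c) * (c - 2) * (b*c^2 - 4*b*c + 2 + 4*b) *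
     (2*b*c^2 - c^2 - 4*b*c + 2*b)
     / (Delta b c * (b*c - 1 - b)^2 * (b*c - c - 2*b)^2)"

definition P :: "rat \<Rightarrow> rat \<Rightarrow> rat poly" where
  "P b c = [: - E30 b c, E20 b c, - E10 b c, 1 :]"

definition Q :: "rat \<Rightarrow> rat \<Rightarrow> rat poly" where
  "Q b c = [: - E03 b c, E02 b c, - E01 b c, 1 :]"

end

theory Submission
  imports Defs
begin

text \<open>A cubic over a field that has a root splits off a linear factor, so one rational root of
  each polynomial suffices (\<open>root_imp_not_irreducible\<close>). The hypothesis says that the
  last factor in the numerator of \<open>E30\<close> vanishes, hence \<open>P\<close> has constant
  term 0. For \<open>Q\<close>, the value at 1 is a fraction whose numerator vanishes on the curve
  2b(c-1)^2 = c^2 (\<open>poly_Q_1_eq_0\<close>).\<close>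

lemma root_imp_not_irreducible:
  fixes p :: "'a :: field poly"
  assumes "poly p a = 0" and "degree p > 1"
  shows "\<not> irreducible p"
proof
  assume irr: "irreducible p"
  obtain q where q: "p = [:- a, 1:] * q"
    using assms(1) by (auto simp: poly_eq_0_iff_dvd)
  have "q \<noteq> 0"
    using q assms(2) by auto
  then have "degree p = 1 + degree q"
    unfolding q by (subst degree_mult_eq) auto
  \<comment> \<open>The bound on the degree enters here: a linear \<open>p\<close> also has a root,
    but its cofactor \<open>q\<close> is a constant, hence a unit.\<close>
  with assms(2) have "\<not> is_unit q"
    by (auto simp: is_unit_iff_degree[OF \<open>q \<noteq> 0\<close>])
  moreover have "\<not> is_unit [:- a, 1:]"
    by (simp add: is_unit_iff_degree)
  ultimately show False
    using irreducibleD[OF irr q] by blast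
qed

text \<open>Puts \<open>E01\<close> over factors that also occur in the denominators of
  \<open>E02\<close> and \<open>E03\<close>.\<close>

lemma DD_factor: "DD b c = (b*c - 1 - b) * (b*c - c - 2*b)"
  unfolding DD_def by algebra

lemma poly_Q_1_eq_0:
  assumes "Delta b c * (b*c - 1 - b) * (b*c - c - 2*b) \<noteq> 0"
    and "2*b*c^2 - 4*b*c + 2*b - c^2 = 0"
  shows "poly (Q b c) 1 = 0"
proof -
  \<comment> \<open>Naming the factors and numerators keeps them opaque while fractions are
    combined; they are expanded only for the polynomial identity.\<close>
  define s where "s = Delta b c"
  define u where "u = b*c - 1 - b"
  define v where "v = b*c - c - 2*b"
  define n01 where "n01 = b*(c^2 + 2 - 2*c)"
  define n02 where "n02 = 28*b^2*c^2 - 16*b^2*c - 2*c^2 - 4*b^2 - b^2*c^4 + 4*b^3*c^4 - 12*b^3*c^3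
      + 4*b*c^3 + 24*b^3*c - 8*b*c - 2*b^4*c^4 + 12*b^4*c^3 - 26*b^4*c^2
      - 8*b^2*c^3 + 24*b^4*c - 16*b^3 - 8*b^4"
  define n03 where "n03 = b *
     (b^2*c^4 - 5*b^2*c^3 + 10*b^2*c^2 - 10*b^2*c + 4*b^2 + 2*b*c + 2*c^2 - b*c^3) *
     (2*b^2*c^4 - 12*b^2*c^3 + 26*b^2*c^2 - 24*b^2*c + 8*b^2 - c^4*b + 3*b*c^3
      - 6*b*c + 4*b + c^3 - 2*c^2 + 2*c)"
  have nz: "s \<noteq> 0" "u \<noteq> 0" "v \<noteq> 0"
    using assms(1) by (auto simp: s_def u_def v_def)
  \<comment> \<open>The factors 1/2 of \<open>E02\<close> and \<open>E03\<close> move into the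
    denominators, so \<open>2 * s * u^2 * v^2\<close> is common to all three.\<close>
  have E: "E01 b c = - (n01 / (u * v))" "E02 b c = n02 / (2 * u^2 * v^2)"
      "E03 b c = n03 / (2 * s * u^2 * v^2)"
    unfolding E01_def E02_def E03_def DD_factor
      s_def[symmetric] u_def[symmetric] v_def[symmetric]
      n01_def[symmetric] n02_def[symmetric]
    by (simp_all add: n03_def)
  \<comment> \<open>This is Q(1) times the common denominator; as a polynomial in \<open>b\<close>
    and \<open>c\<close> it is a multiple of 2b(c-1)^2 - c^2.\<close>
  have "2 * s * u^2 * v^2 + 2 * s * u * v * n01 + s * n02 - n03 = 0"
    using assms(2) unfolding s_def u_def v_def n01_def n02_def n03_def Delta_def
    by algebra
  moreover have "1 - E01 b c + E02 b c - E03 b c =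
      (2 * s * u^2 * v^2 + 2 * s * u * v * n01 + s * n02 - n03) / (2 * s * u^2 * v^2)"
    unfolding E using nz
    by (simp add: add_divide_distrib diff_divide_distrib power2_eq_square)
  ultimately have "1 - E01 b c + E02 b c - E03 b c = 0"
    by simp
  then show ?thesis
    by (simp add: Q_def)
qed

theorem theorem6p2:
  fixes b c :: rat
  assumes "Delta b c * (b*c - 1 - b) * (b*c - c - 2*b) \<noteq> 0"
    and "2*b*c^2 - 4*b*c + 2*b - c^2 = 0"
  shows "\<not> irreducible (P b c) \<and> \<not> irreducible (Q b c) \<and>
         poly (P b c) 0 = 0 \<and> poly (Q b c) 1 = 0"
proof -
  have "2*b*c^2 - c^2 - 4*b*c + 2*b = 0"
    using assms(2) by simp
  then have P: "poly (P b c) 0 = 0"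
    by (simp add: P_def E30_def)
  have Q: "poly (Q b c) 1 = 0"
    using assms by (rule poly_Q_1_eq_0)
  have "degree (P b c) > 1" "degree (Q b c) > 1"
    by (simp_all add: P_def Q_def)
  with P Q show ?thesis
    using root_imp_not_irreducible by blast
qed

end
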